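(* Let $(F,W,P,\boldsymbol{q})$ be a many-to-one matching market (with strict preferences, and $\boldsymbol{q}$-responsive preferences for firms). Let $x$ be a non-integer extreme point of the convex polytope $SCP$. Then $x$ is not a strongly stable fractional matching.
   Context: MARKET. $F$ (firms) and $W$ (workers) are finite disjoint sets. Each worker $w$ has a strict linear order $\succ_w$ on $F\cup\{w\}$ ($w$ stands for being unmatched). Each firm $f$ has a quota $q_f$ (a positive integer) and a strict linear order $\succ_f$ on $2^W$; $\boldsymbol q=(q_f)_{f\in F}$; $P$ is the profile of all these preferences. $\succeq$ denotes "$\succ$ or equal". For workers $j,w$ write $j\succ_f w$ for $\{j\}\succ_f\{w\}$. Firms' preferences are $\boldsymbol q$-responsive: (1) $\emptyset\succ_f T$ whenever $|T|>q_f$; (2) if $|T|<q_f$ and $w\notin T$, then $T\cup\{w\}\succ_f T$ iff $\{w\}\succ_f\emptyset$; (3) if $|T|<q_f$ and $w,w'\notin T$, then $T\cup\{w\}\succ_f T\cup\{w'\}$ iff $w\succ_f w'$. A pair $(f,w)$ is acceptable if $\{w\}\succ_f\emptyset$ and $f\succ_w w$; $A=A(P)$ is the set of acceptable pairs. POLYTOPES. $CP$ is the set of $x\in\mathbb{R}^{F\times W}$ with $\sum_{j\in W}x_{f,j}\le q_f$ for all $f$; $\sum_{i\in F}x_{i,w}\le 1$ for all $w$; $x_{f,w}\ge0$ for all $(f,w)$; $x_{f,w}=0$ for $(f,w)\notin A$. $SCP$ is the set of $x\in CP$ with $$\sum_{j\succ_f w}x_{f,j}+q_f\sum_{i\succ_w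 f}x_{i,w}+q_fx_{f,w}\ge q_f\quad\text{for all }(f,w)\in A.$$ A strongly stable fractional matching is a (not necessarily integer) point $\bar x\in CP$ such that for every $(f,w)\in A$, $$\Bigl[q_f-\sum_{j\succeq_f w}\bar x_{f,j}\Bigr]\cdot\Bigl[1-\sum_{i\succeq_w f}\bar x_{i,w}\Bigr]=0.$$ Sums over $j$ range over workers, sums over $i$ over firms. *)

theory Defs
  imports "HOL-Analysis.Analysis"
begin

text \<open>
  Firms and workers are the elements of two finite types (hence disjoint sets).
  A pair \<open>(a, b)\<close> in a preference relation means that \<open>a\<close> is strictly preferred to \<open>b\<close>.
  In a worker's preference, \<open>None\<close> stands for being unmatched and \<open>Some f\<close> for working at \<open>f\<close>.
\<close>

type_synonym ('f, 'w) firm_prefs = "'f \<Rightarrow> ('w set) rel"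
type_synonym ('f, 'w) worker_prefs = "'w \<Rightarrow> ('f option) rel"

definition q_responsive :: "('w set) rel \<Rightarrow> nat \<Rightarrow> bool" where
  "q_responsive r q \<longleftrightarrow>
     (\<forall>T. card T > q \<longrightarrow> ({}, T) \<in> r) \<and>
     (\<forall>T w. card T < q \<longrightarrow> w \<notin> T \<longrightarrow>
        ((T \<union> {w}, T) \<in> r \<longleftrightarrow> ({w}, {}) \<in> r)) \<and>
     (\<forall>T w w'. card T < q \<longrightarrow> w \<notin> T \<longrightarrow> w' \<notin> T \<longrightarrow>
        ((T \<union> {w}, T \<union> {w'}) \<in> r \<longleftrightarrow> ({w}, {w'}) \<in> r))"

definition many_to_one_market ::
    "('f::finite, 'w::finite) firm_prefs \<Rightarrow> ('f, 'w) worker_prefs \<Rightarrow> ('f \<Rightarrow> nat) \<Rightarrow> bool" where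
  "many_to_one_market PF PW q \<longleftrightarrow>
     (\<forall>w. strict_linear_order_on UNIV (PW w)) \<and>
     (\<forall>f. strict_linear_order_on UNIV (PF f)) \<and>
     (\<forall>f. q f > 0) \<and>
     (\<forall>f. q_responsive (PF f) (q f))"

definition firm_prefers :: "('f, 'w) firm_prefs \<Rightarrow> 'f \<Rightarrow> 'w \<Rightarrow> 'w \<Rightarrow> bool" where
  "firm_prefers PF f j w \<longleftrightarrow> ({j}, {w}) \<in> PF f"

definition worker_prefers :: "('f, 'w) worker_prefs \<Rightarrow> 'w \<Rightarrow> 'f \<Rightarrow> 'f \<Rightarrow> bool" where
  "worker_prefers PW w i f \<longleftrightarrow> (Some i, Some f) \<in> PW w"

definition acceptable_pairs ::
    "('f, 'w) firm_prefs \<Rightarrow> ('f, 'w) worker_prefs \<Rightarrow> ('f \<times> 'w) set" where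
  "acceptable_pairs PF PW = {(f, w). ({w}, {}) \<in> PF f \<and> (Some f, None) \<in> PW w}"

definition CP ::
    "('f::finite, 'w::finite) firm_prefs \<Rightarrow> ('f, 'w) worker_prefs \<Rightarrow> ('f \<Rightarrow> nat)
       \<Rightarrow> (real ^ ('f \<times> 'w)) set" where
  "CP PF PW q = {x.
     (\<forall>f. (\<Sum>j\<in>UNIV. x $ (f, j)) \<le> real (q f)) \<and>
     (\<forall>w. (\<Sum>i\<in>UNIV. x $ (i, w)) \<le> 1) \<and>
     (\<forall>f w. x $ (f, w) \<ge> 0) \<and>
     (\<forall>f w. (f, w) \<notin> acceptable_pairs PF PW \<longrightarrow> x $ (f, w) = 0)}"

definition SCP ::
    "('f::finite, 'w::finite) firm_prefs \<Rightarrow> ('f, 'w) worker_prefs \<Rightarrow> ('f \<Rightarrow> nat)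
       \<Rightarrow> (real ^ ('f \<times> 'w)) set" where
  "SCP PF PW q = {x \<in> CP PF PW q.
     \<forall>(f, w) \<in> acceptable_pairs PF PW.
       (\<Sum>j | firm_prefers PF f j w. x $ (f, j))
         + real (q f) * (\<Sum>i | worker_prefers PW w i f. x $ (i, w))
         + real (q f) * x $ (f, w) \<ge> real (q f)}"

definition strongly_stable_fractional_matching ::
    "('f::finite, 'w::finite) firm_prefs \<Rightarrow> ('f, 'w) worker_prefs \<Rightarrow> ('f \<Rightarrow> nat)
       \<Rightarrow> real ^ ('f \<times> 'w) \<Rightarrow> bool" where
  "strongly_stable_fractional_matching PF PW q x \<longleftrightarrow>
     x \<in> CP PF PW q \<and>
     (\<forall>(f, w) \<in> acceptable_pairs PF PW.
        (real (q f) - (\<Sum>j | firm_prefers PF f j w \<or> j = w. x $ (f, j)))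
          * (1 - (\<Sum>i | worker_prefers PW w i f \<or> i = f. x $ (i, w))) = 0)"

end

theory Submission
  imports Defs
begin

text \<open>
  Let \<open>x\<close> be strongly stable. On an edge \<open>(f, w)\<close> of the support, strong stability says that
  either \<open>f\<close> is full and \<open>w\<close> is its worst partner, or \<open>w\<close> is full and \<open>f\<close> is its worst
  partner. Let \<open>B\<close> be the set of non-integral edges of the first kind. Since quotas are integers,
  a firm \<open>f\<close> with \<open>(f, w)\<close> in \<open>B\<close> has another non-integral edge \<open>(f, w')\<close>; it is of the second
  kind, so \<open>w'\<close> has another non-integral edge \<open>(f', w')\<close>, which lies in \<open>B\<close>. As \<open>f\<close> is the worst
  partner of \<open>w'\<close> and \<open>w\<close> that of \<open>f\<close>, the map sending \<open>(f, w)\<close> to \<open>(f', w')\<close> is injective, hence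
  a permutation of \<open>B\<close>. Moving weight from \<open>(f, w)\<close> to \<open>(f, w')\<close> for all \<open>(f, w)\<close> in \<open>B\<close> at once
  therefore preserves all row and column sums, and any perturbation of \<open>x\<close> within its support that
  preserves them stays in \<open>SCP\<close>. It can be applied with either sign, so \<open>x\<close> is not extreme.
\<close>

section \<open>Sums over weak upper sets, integrality and small multiples\<close>

text \<open>The entries outside the weak upper set of \<open>a\<close> are nonnegative and sum to at
  most \<open>c - c\<close>, so they all vanish. Leaving \<open>R\<close> and \<open>c\<close>
  general covers firms (\<open>c\<close> the quota) and workers (\<open>c = 1\<close>)
  alike.\<close>

lemma weak_upper_sum_eq_bound:
  fixes y :: "'a::finite \<Rightarrow> real"
  assumes nonneg: "\<And>j. 0 \<le> y j"
    and total: "(\<Sum>j\<in>UNIV. y j) \<le> c"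
    and full: "(\<Sum>j | R j a \<or> j = a. y j) = c"
  shows "(\<Sum>j\<in>UNIV. y j) = c" and "\<And>b. y b \<noteq> 0 \<Longrightarrow> R b a \<or> b = a"
proof -
  have split: "(\<Sum>j\<in>UNIV. y j)
      = (\<Sum>j | R j a \<or> j = a. y j) + (\<Sum>j | \<not> (R j a \<or> j = a). y j)"
    by (subst sum.union_disjoint [symmetric]) (auto intro: sum.cong)
  have "0 \<le> (\<Sum>j | \<not> (R j a \<or> j = a). y j)"
    by (simp add: nonneg sum_nonneg)
  then have zero: "(\<Sum>j | \<not> (R j a \<or> j = a). y j) = 0"
    using split total full by linarith
  show "(\<Sum>j\<in>UNIV. y j) = c"
    using split zero full by linarith
  show "R b a \<or> b = a" if "y b \<noteq> 0" for b
    using zero that by (subst (asm) sum_nonneg_eq_0_iff) (auto simp: nonneg)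
qed

text \<open>Fullness at \<open>a\<close> puts \<open>b\<close> above \<open>a\<close>, so by
  asymmetry the weak upper set of \<open>b\<close> misses the positive entry \<open>y a\<close>.
  Hence an agent has at most one worst partner in its support.\<close>

lemma weak_upper_sum_less_bound:
  fixes y :: "'a::finite \<Rightarrow> real"
  assumes "asymp R"
    and nonneg: "\<And>j. 0 \<le> y j"
    and total: "(\<Sum>j\<in>UNIV. y j) \<le> c"
    and full: "(\<Sum>j | R j a \<or> j = a. y j) = c"
    and "y a \<noteq> 0" "y b \<noteq> 0" "b \<noteq> a"
  shows "(\<Sum>j | R j b \<or> j = b. y j) < c"
proof -
  have "R b a"
    using weak_upper_sum_eq_bound(2) [where y = y and R = R, OF nonneg total full] assms by blast
  then have "a \<notin> {j. R j b \<or> j = b}"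
    using \<open>asymp R\<close> \<open>b \<noteq> a\<close> by (auto dest: asympD)
  then have "(\<Sum>j | R j b \<or> j = b. y j) < (\<Sum>j\<in>UNIV. y j)"
    using \<open>y a \<noteq> 0\<close> nonneg by (intro sum_strict_mono2 [where b = a]) (auto simp: less_le)
  then show ?thesis
    using total by linarith
qed

lemma another_non_integer:
  fixes y :: "'a::finite \<Rightarrow> real"
  assumes "(\<Sum>j\<in>UNIV. y j) \<in> \<int>" "y a \<notin> \<int>"
  obtains b where "b \<noteq> a" "y b \<notin> \<int>"
proof (rule ccontr)
  assume "\<not> thesis"
  then have "(\<Sum>j\<in>UNIV - {a}. y j) \<in> \<int>"
    using that by (intro Ints_sum) auto
  moreover have "y a = (\<Sum>j\<in>UNIV. y j) - (\<Sum>j\<in>UNIV - {a}. y j)"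
    by (subst sum.remove [where x = a]) auto
  ultimately show False
    using assms by (metis Ints_diff)
qed

text \<open>Each inequality holds for all small enough positive \<open>e\<close>, trivially where
  \<open>x p = 0\<close>; as there are finitely many, one \<open>e\<close> serves them all.\<close>

lemma small_multiple_bounded:
  fixes x d :: "'a::finite \<Rightarrow> real"
  assumes "\<And>p. 0 \<le> x p" "\<And>p. x p = 0 \<Longrightarrow> d p = 0"
  obtains e where "0 < e" "\<And>p. e * \<bar>d p\<bar> \<le> x p"
proof -
  have "eventually (\<lambda>e. e * \<bar>d p\<bar> \<le> x p) (at_right 0)" for p
  proof (cases "x p = 0")
    case False
    have "((\<lambda>e. e * \<bar>d p\<bar>) \<longlongrightarrow> 0 * \<bar>d p\<bar>) (at_right 0)"
      by (intro tendsto_intros)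
    then have "eventually (\<lambda>e. e * \<bar>d p\<bar> < x p) (at_right 0)"
      using False assms(1) [of p] by (intro order_tendstoD) auto
    then show ?thesis
      by eventually_elim simp
  qed (simp add: assms)
  then have "eventually (\<lambda>e. \<forall>p. e * \<bar>d p\<bar> \<le> x p) (at_right 0)"
    by (simp add: eventually_all_finite)
  then have "eventually (\<lambda>e. 0 < e \<and> (\<forall>p. e * \<bar>d p\<bar> \<le> x p)) (at_right 0)"
    using eventually_at_right_less by eventually_elim auto
  then have "\<exists>e. 0 < e \<and> (\<forall>p. e * \<bar>d p\<bar> \<le> x p)"
    by (rule eventually_happens'[rotated]) simp
  then show ?thesis
    using that by blast
qed

lemma sum_of_bool_row:
  "(\<Sum>j\<in>UNIV. of_bool (b = (f, j :: 'b::finite)) :: real) = of_bool (fst b = f)"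
  by (cases b; cases "fst b = f") (simp_all add: of_bool_def)

lemma sum_of_bool_column:
  "(\<Sum>i\<in>UNIV. of_bool (b = (i :: 'a::finite, w)) :: real) = of_bool (snd b = w)"
  by (cases b; cases "snd b = w") (simp_all add: of_bool_def)

lemma asymp_firm_prefers:
  assumes "strict_linear_order_on UNIV (PF f)"
  shows "asymp (firm_prefers PF f)"
  using assms unfolding firm_prefers_def strict_linear_order_on_def
  by (intro asympI) (meson irreflD transD)

lemma asymp_worker_prefers:
  assumes "strict_linear_order_on UNIV (PW w)"
  shows "asymp (worker_prefers PW w)"
  using assms unfolding worker_prefers_def strict_linear_order_on_def
  by (intro asympI) (meson irreflD transD)

section \<open>Perturbations with fixed row and column sums\<close>

text \<open>If \<open>f\<close> has a full weak upper sum at \<open>w\<close>, then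
  \<open>x\<close>, and with it \<open>y\<close>, vanishes on the rest of row \<open>f\<close>, so
  the row sum \<open>q f\<close> of \<open>y\<close> is collected above and at \<open>w\<close>. The
  worker side is alike with column sum 1. Either case alone gives the stability inequality.\<close>

lemma strongly_stable_perturbation_in_SCP:
  fixes x y :: "real ^ ('f::finite \<times> 'w::finite)"
  assumes stable: "strongly_stable_fractional_matching PF PW q x"
    and pos: "\<And>f. q f > 0"
    and asym: "\<And>f. asymp (firm_prefers PF f)" "\<And>w. asymp (worker_prefers PW w)"
    and nonneg: "\<And>f w. 0 \<le> y $ (f, w)"
    and supp: "\<And>f w. x $ (f, w) = 0 \<Longrightarrow> y $ (f, w) = 0"
    and rows: "\<And>f. (\<Sum>j\<in>UNIV. y $ (f, j)) = (\<Sum>j\<in>UNIV. x $ (f, j))"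
    and cols: "\<And>w. (\<Sum>i\<in>UNIV. y $ (i, w)) = (\<Sum>i\<in>UNIV. x $ (i, w))"
  shows "y \<in> SCP PF PW q"
proof -
  have x: "x \<in> CP PF PW q"
    and prod: "(f, w) \<in> acceptable_pairs PF PW \<Longrightarrow>
        (real (q f) - (\<Sum>j | firm_prefers PF f j w \<or> j = w. x $ (f, j)))
          * (1 - (\<Sum>i | worker_prefers PW w i f \<or> i = f. x $ (i, w))) = 0" for f w
    using stable by (auto simp: strongly_stable_fractional_matching_def)
  have xnonneg: "0 \<le> x $ (f, w)"
    and xrow: "(\<Sum>j\<in>UNIV. x $ (f, j)) \<le> real (q f)"
    and xcol: "(\<Sum>i\<in>UNIV. x $ (i, w)) \<le> 1" for f w
    using x by (auto simp: CP_def)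
  have y: "y \<in> CP PF PW q"
    using x supp nonneg rows cols by (auto simp: CP_def)
  have "real (q f) \<le> (\<Sum>j | firm_prefers PF f j w. y $ (f, j))
      + real (q f) * (\<Sum>i | worker_prefers PW w i f. y $ (i, w)) + real (q f) * y $ (f, w)"
    if acc: "(f, w) \<in> acceptable_pairs PF PW" for f w
  proof -
    have upper_nonneg: "0 \<le> (\<Sum>j | firm_prefers PF f j w. y $ (f, j))"
        "0 \<le> (\<Sum>i | worker_prefers PW w i f. y $ (i, w))"
      by (simp_all add: nonneg sum_nonneg)
    consider "(\<Sum>j | firm_prefers PF f j w \<or> j = w. x $ (f, j)) = real (q f)"
      | "(\<Sum>i | worker_prefers PW w i f \<or> i = f. x $ (i, w)) = 1"
      using prod [OF acc] by auto
    then show ?thesis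
    proof cases
      case 1
      note full = weak_upper_sum_eq_bound
        [where y = "\<lambda>j. x $ (f, j)" and R = "firm_prefers PF f", OF xnonneg xrow 1]
      have "real (q f) = (\<Sum>j\<in>UNIV. y $ (f, j))"
        using full(1) rows by simp
      also have "\<dots> = (\<Sum>j\<in>insert w {j. firm_prefers PF f j w}. y $ (f, j))"
        using full(2) supp by (intro sum.mono_neutral_right) auto
      also have "\<dots> = y $ (f, w) + (\<Sum>j | firm_prefers PF f j w. y $ (f, j))"
        using asym(1) by (subst sum.insert) (auto dest: asympD)
      finally have "real (q f) = y $ (f, w) + (\<Sum>j | firm_prefers PF f j w. y $ (f, j))" .
      \<comment> \<open>The row sum counts this entry once, the constraint \<open>q f\<close> times;
        a quota of at least 1 bridges the gap.\<close>
      moreover have "y $ (f, w) \<le> real (q f) * y $ (f, w)"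
        using mult_right_mono [of 1 "real (q f)" "y $ (f, w)"] pos [of f] nonneg
        by (simp add: Suc_le_eq)
      moreover have "0 \<le> real (q f) * (\<Sum>i | worker_prefers PW w i f. y $ (i, w))"
        using upper_nonneg by simp
      ultimately show ?thesis
        by linarith
    next
      case 2
      note full = weak_upper_sum_eq_bound
        [where y = "\<lambda>i. x $ (i, w)" and R = "worker_prefers PW w", OF xnonneg xcol 2]
      have "1 = (\<Sum>i\<in>UNIV. y $ (i, w))"
        using full(1) cols by simp
      also have "\<dots> = (\<Sum>i\<in>insert f {i. worker_prefers PW w i f}. y $ (i, w))"
        using full(2) supp by (intro sum.mono_neutral_right) auto
      also have "\<dots> = y $ (f, w) + (\<Sum>i | worker_prefers PW w i f. y $ (i, w))"
        using asym(2) by (subst sum.insert) (auto dest: asympD)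
      finally have "real (q f)
          = real (q f) * (y $ (f, w) + (\<Sum>i | worker_prefers PW w i f. y $ (i, w)))"
        by simp
      then show ?thesis
        using upper_nonneg by (simp add: algebra_simps)
    qed
  qed
  with y show ?thesis
    unfolding SCP_def by blast
qed

section \<open>A direction with zero row and column sums\<close>

lemma strongly_stable_balanced_direction:
  fixes x :: "real ^ ('f::finite \<times> 'w::finite)"
  assumes stable: "strongly_stable_fractional_matching PF PW q x"
    and asym: "\<And>f. asymp (firm_prefers PF f)" "\<And>w. asymp (worker_prefers PW w)"
    and nonint: "\<not> (\<forall>f w. x $ (f, w) \<in> \<int>)"
  shows "\<exists>d :: real ^ ('f \<times> 'w). d \<noteq> 0 \<and> (\<forall>f w. x $ (f, w) = 0 \<longrightarrow> d $ (f, w) = 0)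
    \<and> (\<forall>f. (\<Sum>j\<in>UNIV. d $ (f, j)) = 0) \<and> (\<forall>w. (\<Sum>i\<in>UNIV. d $ (i, w)) = 0)"
proof -
  \<comment> \<open>On the support of \<open>x\<close>, \<open>Ffull f w\<close> says that
    \<open>f\<close> fills its quota and \<open>w\<close> is its worst partner;
    \<open>Wfull w f\<close> is the mirror image.\<close>
  define Ffull where "Ffull f w \<longleftrightarrow>
    (\<Sum>j | firm_prefers PF f j w \<or> j = w. x $ (f, j)) = real (q f)" for f w
  define Wfull where "Wfull w f \<longleftrightarrow>
    (\<Sum>i | worker_prefers PW w i f \<or> i = f. x $ (i, w)) = 1" for w f
  have x: "x \<in> CP PF PW q"
    and prod: "(f, w) \<in> acceptable_pairs PF PW \<Longrightarrow> Ffull f w \<or> Wfull w f" for f w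
    using stable by (auto simp: strongly_stable_fractional_matching_def Ffull_def Wfull_def)
  have nonneg: "0 \<le> x $ (f, w)"
    and row: "(\<Sum>j\<in>UNIV. x $ (f, j)) \<le> real (q f)"
    and col: "(\<Sum>i\<in>UNIV. x $ (i, w)) \<le> 1"
    and acc: "x $ (f, w) \<noteq> 0 \<Longrightarrow> (f, w) \<in> acceptable_pairs PF PW" for f w
    using x by (auto simp: CP_def)
  have full_cases: "Ffull f w \<or> Wfull w f" if "x $ (f, w) \<noteq> 0" for f w
    using acc prod that by blast
  have Ffull_unique: "w = w'"
    if "Ffull f w" "Ffull f w'" "x $ (f, w) \<noteq> 0" "x $ (f, w') \<noteq> 0" for f w w'
    using weak_upper_sum_less_bound
      [where y = "\<lambda>j. x $ (f, j)" and R = "firm_prefers PF f" and a = w and b = w',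
        OF asym(1) nonneg row] that
    by (auto simp: Ffull_def)
  have Wfull_unique: "f = f'"
    if "Wfull w f" "Wfull w f'" "x $ (f, w) \<noteq> 0" "x $ (f', w) \<noteq> 0" for w f f'
    using weak_upper_sum_less_bound
      [where y = "\<lambda>i. x $ (i, w)" and R = "worker_prefers PW w" and a = f and b = f',
        OF asym(2) nonneg col] that
    by (auto simp: Wfull_def)
  have nonint_nz: "t \<noteq> 0" if "t \<notin> \<int>" for t :: real
    using that by auto
  have another_worker: "\<exists>w'. w' \<noteq> w \<and> x $ (f, w') \<notin> \<int> \<and> Wfull w' f"
    if "Ffull f w" "x $ (f, w) \<notin> \<int>" for f w
  proof -
    have "(\<Sum>j\<in>UNIV. x $ (f, j)) \<in> \<int>"
      using weak_upper_sum_eq_bound(1)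
        [where y = "\<lambda>j. x $ (f, j)" and R = "firm_prefers PF f", OF nonneg row] that(1)
      by (simp add: Ffull_def)
    from this that(2) obtain w' where "w' \<noteq> w" "x $ (f, w') \<notin> \<int>"
      by (rule another_non_integer)
    then show ?thesis
      using full_cases [of f w'] Ffull_unique [of f w w'] that nonint_nz by blast
  qed
  have another_firm: "\<exists>f'. f' \<noteq> f \<and> x $ (f', w) \<notin> \<int> \<and> Ffull f' w"
    if "Wfull w f" "x $ (f, w) \<notin> \<int>" for f w
  proof -
    have "(\<Sum>i\<in>UNIV. x $ (i, w)) \<in> \<int>"
      using weak_upper_sum_eq_bound(1)
        [where y = "\<lambda>i. x $ (i, w)" and R = "worker_prefers PW w", OF nonneg col] that(1)
      by (simp add: Wfull_def)
    from this that(2) obtain f' where "f' \<noteq> f" "x $ (f', w) \<notin> \<int>"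
      by (rule another_non_integer)
    then show ?thesis
      using full_cases [of f' w] Wfull_unique [of w f f'] that nonint_nz by blast
  qed

  define B where "B = {p. x $ p \<notin> \<int> \<and> Ffull (fst p) (snd p)}"
  \<comment> \<open>Two moves, from firm to worker to firm, joined by the edge
    \<open>(fst p, snd p')\<close>. Its non-integrality keeps it in the support, the
    \<open>Wfull\<close> clause gives injectivity, and the change of worker keeps the direction
    nonzero.\<close>
  have "\<exists>p'. p' \<in> B \<and> snd p' \<noteq> snd p \<and> x $ (fst p, snd p') \<notin> \<int> \<and> Wfull (snd p') (fst p)"
    if "p \<in> B" for p
  proof -
    have "Ffull (fst p) (snd p)" "x $ (fst p, snd p) \<notin> \<int>"
      using that by (simp_all add: B_def)
    from another_worker [OF this] obtain w'
      where w': "w' \<noteq> snd p" "x $ (fst p, w') \<notin> \<int>" "Wfull w' (fst p)"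
      by blast
    from another_firm [OF w'(3,2)] obtain f' where "x $ (f', w') \<notin> \<int>" "Ffull f' w'"
      by blast
    with w' show ?thesis
      by (intro exI [of _ "(f', w')"]) (simp add: B_def)
  qed
  then obtain n where n: "\<And>p. p \<in> B \<Longrightarrow> n p \<in> B"
      "\<And>p. p \<in> B \<Longrightarrow> snd (n p) \<noteq> snd p"
      "\<And>p. p \<in> B \<Longrightarrow> x $ (fst p, snd (n p)) \<notin> \<int>"
      "\<And>p. p \<in> B \<Longrightarrow> Wfull (snd (n p)) (fst p)"
    by metis
  have B_eqI: "p = p'" if "p \<in> B" "p' \<in> B" "fst p = fst p'" for p p'
    using that Ffull_unique nonint_nz by (cases p; cases p') (auto simp: B_def)
  have "inj_on n B"
  proof (rule inj_onI)
    fix p p'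
    assume p: "p \<in> B" "p' \<in> B" and eq: "n p = n p'"
    \<comment> \<open>Both firms are the worst partner of the common worker
      \<open>snd (n p)\<close>, so they coincide.\<close>
    have "Wfull (snd (n p)) (fst p')" "x $ (fst p', snd (n p)) \<notin> \<int>"
      using n(3,4) [OF p(2)] eq by simp_all
    then have "fst p = fst p'"
      using n(3,4) [OF p(1)] by (intro Wfull_unique nonint_nz)
    with p show "p = p'"
      by (rule B_eqI)
  qed
  then have n_bij: "bij_betw n B B"
    using n(1) by (simp add: bij_betw_def endo_inj_surj image_subsetI)

  \<comment> \<open>Each \<open>b\<close> in \<open>B\<close> contributes the unit vector of its
    joining edge minus its own unit vector.\<close>
  define d :: "real ^ ('f \<times> 'w)"
    where "d = (\<chi> p. \<Sum>b\<in>B. of_bool ((fst b, snd (n b)) = p) - of_bool (b = p))"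
  show ?thesis
  proof (intro exI [of _ d] conjI allI impI)
    obtain f w where "x $ (f, w) \<notin> \<int>"
      using nonint by blast
    \<comment> \<open>Either the given edge is itself in \<open>B\<close>, or its worker has another
      non-integral edge that is.\<close>
    then have "\<exists>f'. (f', w) \<in> B"
      using full_cases [of f w] another_firm [of w f] nonint_nz by (auto simp: B_def)
    then obtain p where p: "p \<in> B"
      by blast
    \<comment> \<open>No joining edge lies in \<open>B\<close>, so nothing cancels the entry -1 at
      \<open>p\<close>.\<close>
    have "(fst b, snd (n b)) \<noteq> p" if "b \<in> B" for b
    proof
      assume eq: "(fst b, snd (n b)) = p"
      then have "b = p"
        using B_eqI [OF that p] by auto
      with eq n(2) [OF that] show False
        by (metis snd_conv)
    qed
    then have "d $ p = (\<Sum>b\<in>B. - of_bool (b = p))"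
      by (simp add: d_def)
    also have "\<dots> = - 1"
      using p by (simp add: sum_negf of_bool_def sum.delta)
    finally show "d \<noteq> 0"
      by auto
  next
    fix f w
    assume "x $ (f, w) = 0"
    then have "(fst b, snd (n b)) \<noteq> (f, w) \<and> b \<noteq> (f, w)" if "b \<in> B" for b
      using n(3) [OF that] that by (auto simp: B_def)
    then show "d $ (f, w) = 0"
      by (auto simp: d_def intro!: sum.neutral)
  next
    fix f
    have "(\<Sum>j\<in>UNIV. d $ (f, j))
        = (\<Sum>b\<in>B. (\<Sum>j\<in>UNIV. of_bool ((fst b, snd (n b)) = (f, j)))
            - (\<Sum>j\<in>UNIV. of_bool (b = (f, j))))"
      unfolding d_def vec_lambda_beta by (subst sum.swap) (simp only: sum_subtractf)
    \<comment> \<open>An edge and its joining edge share the firm, so rows cancel term by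
      term.\<close>
    also have "\<dots> = 0"
      by (simp only: sum_of_bool_row fst_conv diff_self sum.neutral_const)
    finally show "(\<Sum>j\<in>UNIV. d $ (f, j)) = 0" .
  next
    fix w
    have "(\<Sum>i\<in>UNIV. d $ (i, w))
        = (\<Sum>b\<in>B. (\<Sum>i\<in>UNIV. of_bool ((fst b, snd (n b)) = (i, w)))
            - (\<Sum>i\<in>UNIV. of_bool (b = (i, w))))"
      unfolding d_def vec_lambda_beta by (subst sum.swap) (simp only: sum_subtractf)
    also have "\<dots> = (\<Sum>b\<in>B. of_bool (snd (n b) = w)) - (\<Sum>b\<in>B. of_bool (snd b = w))"
      by (simp only: sum_of_bool_column snd_conv sum_subtractf)
    \<comment> \<open>Columns cancel only in total, because \<open>n\<close> permutes
      \<open>B\<close>.\<close>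
    also have "\<dots> = 0"
      using sum.reindex_bij_betw [OF n_bij, of "\<lambda>b. of_bool (snd b = w) :: real"] by simp
    finally show "(\<Sum>i\<in>UNIV. d $ (i, w)) = 0" .
  qed
qed

section \<open>Refuting extremality by a midpoint\<close>

theorem corollary1:
  fixes PF :: "('f::finite, 'w::finite) firm_prefs"
    and PW :: "('f, 'w) worker_prefs"
    and q :: "'f \<Rightarrow> nat"
    and x :: "real ^ ('f \<times> 'w)"
  assumes "many_to_one_market PF PW q"
    and "x extreme_point_of SCP PF PW q"
    and "\<not> (\<forall>f w. x $ (f, w) \<in> \<int>)"
  shows "\<not> strongly_stable_fractional_matching PF PW q x"
proof
  assume stable: "strongly_stable_fractional_matching PF PW q x"
  have pos: "q f > 0" for f
    using assms(1) by (simp add: many_to_one_market_def)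
  have asym: "asymp (firm_prefers PF f)" "asymp (worker_prefers PW w)" for f w
    using assms(1)
    by (simp_all add: many_to_one_market_def asymp_firm_prefers asymp_worker_prefers)
  have nonneg: "0 \<le> x $ p" for p
    using stable by (cases p) (auto simp: strongly_stable_fractional_matching_def CP_def)
  obtain d :: "real ^ ('f \<times> 'w)"
    where d: "d \<noteq> 0" "\<forall>f w. x $ (f, w) = 0 \<longrightarrow> d $ (f, w) = 0"
    "\<forall>f. (\<Sum>j\<in>UNIV. d $ (f, j)) = 0" "\<forall>w. (\<Sum>i\<in>UNIV. d $ (i, w)) = 0"
    using strongly_stable_balanced_direction [OF stable asym assms(3)] by blast
  obtain e where e: "0 < e" "\<And>p. e * \<bar>d $ p\<bar> \<le> x $ p"
  proof (rule small_multiple_bounded [of "($) x" "($) d"])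
    show "d $ p = 0" if "x $ p = 0" for p
      using d(2) [rule_format, of "fst p" "snd p"] that by simp
  qed (use nonneg in auto)
  \<comment> \<open>The condition on \<open>s\<close> treats both signs at once; \<open>x\<close> is
    then the midpoint of two distinct points of \<open>SCP\<close>.\<close>
  have perturb: "x + s *\<^sub>R d \<in> SCP PF PW q" if "\<bar>s\<bar> = e" for s
  proof (rule strongly_stable_perturbation_in_SCP [OF stable pos asym])
    show "0 \<le> (x + s *\<^sub>R d) $ (f, w)" for f w
    proof -
      have "\<bar>s * d $ (f, w)\<bar> \<le> x $ (f, w)"
        using e(2) that by (simp add: abs_mult)
      then show ?thesis
        by simp
    qed
    show "(x + s *\<^sub>R d) $ (f, w) = 0" if "x $ (f, w) = 0" for f w
      using d(2) that by simp
    show "(\<Sum>j\<in>UNIV. (x + s *\<^sub>R d) $ (f, j)) = (\<Sum>j\<in>UNIV. x $ (f, j))" for f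
      using d(3) by (simp add: sum.distrib sum_distrib_left [symmetric])
    show "(\<Sum>i\<in>UNIV. (x + s *\<^sub>R d) $ (i, w)) = (\<Sum>i\<in>UNIV. x $ (i, w))" for w
      using d(4) by (simp add: sum.distrib sum_distrib_left [symmetric])
  qed
  have "x - e *\<^sub>R d \<in> SCP PF PW q" "x + e *\<^sub>R d \<in> SCP PF PW q"
    using perturb [of "- e"] perturb [of e] e(1) by simp_all
  moreover have "x = midpoint (x - e *\<^sub>R d) (x + e *\<^sub>R d)"
    by (simp add: midpoint_def vec_eq_iff)
  moreover have "x - e *\<^sub>R d \<noteq> x + e *\<^sub>R d"
    using e(1) d(1) by (auto simp: vec_eq_iff)
  ultimately show False
    using assms(2) midpoint_in_open_segment [of "x - e *\<^sub>R d" "x + e *\<^sub>R d"]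
    by (auto simp: extreme_point_of_def)
qed

end
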